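(* Let $\nu$ be a probability measure on $\mathbb{R}$ with finite second moment. For each natural number $n\ge 1$, let $Y_n$ be an $n\times n$ random real symmetric matrix whose upper triangular entries (including the diagonal) are i.i.d. with distribution $\nu$, and let $X_n=\frac{1}{\sqrt{n}}Y_n$. Then the empirical law of eigenvalues $\mu_{X_n}$ of $X_n$ converges weakly to its mean in probability; that is, for all $\epsilon>0$ and all Lipschitz $f:\mathbb{R}\to\mathbb{R}$, $$\mathbb{P}\left(\left|\int f\,d\mu_{X_n}-\mathbb{E}\left(\int f\,d\mu_{X_n}\right)\right|\geq\epsilon\right)\to 0\quad\text{as } n\to\infty.$$
   Context: For a real symmetric $n\times n$ matrix $X$ with eigenvalues $\lambda_1,\dots,\lambda_n$ (counted with multiplicity), the empirical law of eigenvalues is the probability measure $\mu_X=\frac{1}{n}\sum_{k=1}^n\delta_{\lambda_k}$, where $\delta_{\lambda}$ is the point mass at $\lambda$. *)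

theory Defs
  imports "HOL-Probability.Probability" "Jordan_Normal_Form.Char_Poly"
begin

text \<open>
  The roots of the characteristic polynomial, with their multiplicities. For a real symmetric matrix
  all complex eigenvalues are real, so that these are all \<open>dim_row X\<close> of them.
\<close>

definition eigenvalue_mset :: "real mat \<Rightarrow> real multiset" where
  "eigenvalue_mset X = proots (char_poly X)"

definition empirical_law :: "real mat \<Rightarrow> real measure" where
  "empirical_law X = measure_of UNIV (sets borel)
     (\<lambda>A. ennreal (1 / real (dim_row X)) * (\<Sum>l\<in>#eigenvalue_mset X. emeasure (return borel l) A))"

lemma space_empirical_law [simp]: "space (empirical_law X) = UNIV"
  by (simp add: empirical_law_def space_measure_of_conv)

lemma sets_empirical_law [simp, measurable_cong]: "sets (empirical_law X) = sets borel"
proof -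
  have "sigma_sets UNIV (sets borel) = sets (borel :: real measure)"
    using sets.sigma_sets_eq[of "borel :: real measure"] by simp
  then show ?thesis
    by (simp add: empirical_law_def sets_measure_of_conv)
qed

text \<open>
  The set function in the definition is countably additive, so \<open>measure_of\<close> does not fall back to
  the zero measure.
\<close>

lemma emeasure_empirical_law:
  assumes "A \<in> sets borel"
  shows "emeasure (empirical_law X) A =
    ennreal (1 / real (dim_row X)) * (\<Sum>l\<in>#eigenvalue_mset X. emeasure (return borel l) A)"
proof (rule emeasure_measure_of[OF empirical_law_def])
  let ?\<mu> = "\<lambda>A. ennreal (1 / real (dim_row X)) *
    (\<Sum>l\<in>#eigenvalue_mset X. emeasure (return borel l) A)"
  show "positive (sets (empirical_law X)) ?\<mu>"
    by (simp add: positive_def)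
  show "countably_additive (sets (empirical_law X)) ?\<mu>"
  proof (rule countably_additiveI)
    fix F :: "nat \<Rightarrow> real set"
    assume F: "range F \<subseteq> sets (empirical_law X)" "disjoint_family F"
    have "(\<Sum>i. \<Sum>l\<in>#E. emeasure (return borel l) (F i)) =
        (\<Sum>l\<in>#E. emeasure (return borel l) (\<Union>i. F i))" for E :: "real multiset"
    proof (induction E)
      case (add l E)
      have "(\<Sum>i. emeasure (return borel l) (F i)) = emeasure (return borel l) (\<Union>i. F i)"
        using F by (intro suminf_emeasure) auto
      then show ?case
        using add by (simp add: suminf_add[symmetric])
    qed simp
    then show "(\<Sum>i. ?\<mu> (F i)) = ?\<mu> (\<Union>i. F i)"
      by (simp only: ennreal_suminf_cmult)
  qed
qed (use assms in auto)

end

theory Submission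
  imports Defs "Jordan_Normal_Form.Schur_Decomposition"
begin

text \<open>
  The theorem holds because a normalised eigenvalue sum \<open>F = (1/n) \<Sum> f(\<lambda>)\<close> is a very smooth function of
  the roughly \<open>n\<^sup>2 / 2\<close> independent entries: a change of one entry by \<open>t\<close> moves \<open>F\<close> by at most
  \<open>2 L |t| / n powr (3/2)\<close>. By an Efron-Stein inequality, the variance of \<open>F\<close> is then at most
  \<open>n\<^sup>2 (2 L / n powr (3/2))\<^sup>2 m = 4 L\<^sup>2 m / n\<close>, where \<open>m\<close> is the second moment of \<open>\<nu>\<close>. Chebyshev's
  inequality concludes (\<open>wigner_deviation_bound\<close>).

  The smoothness is a deterministic fact on eigenvalues: for symmetric \<open>A\<close>, \<open>B\<close> and an \<open>L\<close>-Lipschitz \<open>f\<close>, the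
  sums of \<open>f\<close> over the two spectra differ by at most \<open>L \<Sum> |A\<^sub>i\<^sub>j - B\<^sub>i\<^sub>j|\<close>
  (\<open>eigenvalue_sum_lipschitz_l1\<close>). A bound by the Frobenius norm, as in the Hoffman-Wielandt inequality,
  is weaker by a factor of order \<open>sqrt n\<close> for the change of a single entry and would leave a variance that
  need not tend to zero. The bound by entries rests on monotonicity: if \<open>A \<le> B\<close> as quadratic forms, then \<open>B\<close>
  has at least as many eigenvalues above each level as \<open>A\<close> (\<open>eigenvalue_count_mono\<close>), so the sum of an
  increasing function over the spectrum increases. Applied to the increasing functions \<open>L x + f x\<close> and
  \<open>L x - f x\<close>, this bounds the change of the sum of \<open>f\<close> by \<open>L\<close> times the trace of \<open>B - A\<close>. Incomparable
  matrices are compared through a common upper bound.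

  The variance bound (\<open>l1_lipschitz_variance_le\<close>) is proved on a product of copies of \<open>\<nu>\<close> by induction on the
  number of coordinates. The Lipschitz bound also provides the measurability of \<open>F\<close>, since it makes \<open>F\<close>
  a continuous function of the entries.
\<close>

(* Vectors and matrices below have a dimension given by a number, not by a type. *)
unbundle no inner_syntax
unbundle no vec_syntax

section \<open>The spectral theorem for real symmetric matrices\<close>

text \<open>
  The characteristic polynomial has a complex root \<open>a\<close>, with an eigenvector \<open>z\<close>. By symmetry, \<open>z\<^sup>* A z\<close>
  equals both \<open>a |z|\<^sup>2\<close> and \<open>cnj a |z|\<^sup>2\<close>, so \<open>a\<close> is real and hence an eigenvalue over the reals.
\<close>

lemma real_symmetric_has_eigenvector:
  fixes A :: "real mat"
  assumes A: "A \<in> carrier_mat n n" and sym: "transpose_mat A = A" and n: "n > 0"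
  obtains v e where "v \<in> carrier_vec n" "v \<noteq> 0\<^sub>v n" "A *\<^sub>v v = e \<cdot>\<^sub>v v"
proof -
  define C where "C = map_mat complex_of_real A"
  have C: "C \<in> carrier_mat n n"
    using A by (simp add: C_def)
  obtain as where as: "char_poly C = (\<Prod>a\<leftarrow>as. [:- a, 1:])" "length as = n"
    using char_poly_factorized[OF C] by blast
  then obtain a bs where "as = a # bs"
    using n by (cases as) auto
  then have root: "poly (char_poly C) a = 0"
    using as by simp
  then obtain z where z: "z \<in> carrier_vec n" "z \<noteq> 0\<^sub>v n" "C *\<^sub>v z = a \<cdot>\<^sub>v z"
    using eigenvalue_root_char_poly[OF C] C unfolding eigenvalue_def eigenvector_def by auto
  have Cz: "conjugate (C *\<^sub>v z) = C *\<^sub>v conjugate z"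
    using C z(1) by (intro eq_vecI) (auto simp: C_def scalar_prod_def sum_conjugate conjugate_dist_mul)
  have C_sym: "transpose_mat C = C"
    using sym by (simp add: C_def map_mat_transpose)
  have "a * (conjugate z \<bullet> z) = conjugate z \<bullet> (C *\<^sub>v z)"
    using z by simp
  also have "\<dots> = (C *\<^sub>v conjugate z) \<bullet> z"
    using transpose_vec_mult_scalar[OF C z(1), of "conjugate z"] z(1) C_sym by simp
  also have "\<dots> = cnj a * (conjugate z \<bullet> z)"
    using z(1) by (simp add: Cz[symmetric] z(3) conjugate_smult_vec)
  finally have "a * (conjugate z \<bullet> z) = cnj a * (conjugate z \<bullet> z)" .
  moreover have "conjugate z \<bullet> z \<noteq> 0"
    using z(1,2) by (metis conjugate_square_eq_0_vec conjugate_vec_sprod_comm)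
  ultimately have "cnj a = a" by simp
  then obtain e where e: "a = complex_of_real e"
    by (metis Reals_cases Reals_cnj_iff)
  have "of_real (poly (char_poly A) e) = poly (char_poly C) a"
    by (simp add: C_def e of_real_hom.char_poly_hom[OF A])
  then have "poly (char_poly A) e = 0"
    using root by simp
  then obtain v where "eigenvector A v e"
    using eigenvalue_root_char_poly[OF A] unfolding eigenvalue_def by blast
  then show thesis
    using that A unfolding eigenvector_def by auto
qed

text \<open>
  Gram-Schmidt, applied to a basis that starts with \<open>v\<close>, keeps \<open>v\<close> and yields orthogonal vectors; the
  columns of \<open>W\<close> are these vectors, normalised.
\<close>

lemma orthogonal_matrix_first_column:
  fixes v :: "real vec"
  assumes v: "v \<in> carrier_vec n" "v \<noteq> 0\<^sub>v n" and n: "n > 0"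
  obtains W c where "W \<in> carrier_mat n n" "transpose_mat W * W = 1\<^sub>m n" "col W 0 = c \<cdot>\<^sub>v v"
proof -
  interpret cof_vec_space n "TYPE(real)" .
  define ws where "ws = gram_schmidt n (basis_completion v)"
  note bc = basis_completion[OF v]
  obtain vs where vs: "basis_completion v = v # vs"
    using bc(6,7) n by (cases "basis_completion v") auto
  have hd: "hd ws = v"
    using gram_schmidt_hd[OF v(1), of vs] by (simp add: ws_def vs)
  have ws: "corthogonal ws" "set ws \<subseteq> carrier_vec n" "length ws = n"
    using gram_schmidt_result[OF bc(2,4,5) ws_def] bc(6) by auto
  define us where "us = map (\<lambda>w. (1 / sqrt (w \<bullet> w)) \<cdot>\<^sub>v w) ws"
  have us: "set us \<subseteq> carrier_vec n" "length us = n"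
    using ws by (auto simp: us_def)
  have ort: "us ! i \<bullet> us ! j = (if i = j then 1 else 0)" if "i < n" "j < n" for i j
  proof -
    have c: "ws ! i \<in> carrier_vec n" "ws ! j \<in> carrier_vec n"
      using ws that by auto
    have d: "(ws ! i \<bullet> ws ! j = 0) = (i \<noteq> j)"
      using corthogonalD[OF ws(1), of i j] that ws(3) by simp
    have "ws ! i \<bullet> ws ! i > 0" if "i = j"
      using d that conjugate_square_ge_0_vec[of "ws ! i"] by (simp add: order_less_le)
    then show ?thesis
      using that c d ws(3) by (auto simp: us_def)
  qed
  show thesis
  proof (rule that)
    show W: "mat_of_cols n us \<in> carrier_mat n n"
      using us by auto
    show "transpose_mat (mat_of_cols n us) * mat_of_cols n us = 1\<^sub>m n"
      using us ort by (intro eq_matI) (auto simp: subset_iff)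
    show "col (mat_of_cols n us) 0 = (1 / sqrt (v \<bullet> v)) \<cdot>\<^sub>v v"
      using us ws hd n by (cases ws) (auto simp: us_def)
  qed
qed

lemma orthogonal_mat_right_inverse:
  fixes U :: "real mat"
  assumes "U \<in> carrier_mat n n" "transpose_mat U * U = 1\<^sub>m n"
  shows "U * transpose_mat U = 1\<^sub>m n"
  using assms mat_mult_left_right_inverse[of "transpose_mat U" n U] by simp

text \<open>
  In the basis whose first vector is an eigenvector, the first column of a symmetric matrix vanishes
  below the diagonal, and by symmetry so does the rest of the first row. What remains is a smaller
  symmetric matrix, to which induction applies.
\<close>

lemma symmetric_split_first:
  fixes B :: "real mat"
  assumes B: "B \<in> carrier_mat (Suc m) (Suc m)" and sym: "transpose_mat B = B"
    and col0: "\<And>i. 0 < i \<Longrightarrow> i < Suc m \<Longrightarrow> B $$ (i, 0) = 0"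
  obtains B' where "B' \<in> carrier_mat m m" "transpose_mat B' = B'"
    "B = four_block_mat (mat 1 1 (\<lambda>_. B $$ (0, 0))) (0\<^sub>m 1 m) (0\<^sub>m m 1) B'"
proof
  have symi: "B $$ (i, j) = B $$ (j, i)" if "i < Suc m" "j < Suc m" for i j
    using arg_cong[OF sym, of "\<lambda>M. M $$ (i, j)"] B that by simp
  define B' where "B' = mat m m (\<lambda>(i, j). B $$ (Suc i, Suc j))"
  show "B' \<in> carrier_mat m m" "transpose_mat B' = B'"
    by (auto simp: B'_def symi)
  have row0: "B $$ (0, i) = 0" if "0 < i" "i < Suc m" for i
    using symi[of 0 i] col0 that by simp
  show "B = four_block_mat (mat 1 1 (\<lambda>_. B $$ (0, 0))) (0\<^sub>m 1 m) (0\<^sub>m m 1) B'"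
    using B col0 row0 by (intro eq_matI) (auto simp: B'_def four_block_mat_def Let_def)
qed

theorem real_spectral_theorem:
  fixes A :: "real mat"
  assumes "A \<in> carrier_mat n n" "transpose_mat A = A"
  shows "\<exists>U d. U \<in> carrier_mat n n \<and> transpose_mat U * U = 1\<^sub>m n
    \<and> A = U * mat_diag n d * transpose_mat U"
  using assms
proof (induction n arbitrary: A)
  case 0
  then show ?case
    by (intro exI[of _ "1\<^sub>m 0"] conjI exI[of _ "\<lambda>_. 0"] eq_matI) auto
next
  case (Suc m A)
  note A = Suc.prems(1)
  obtain v e where v: "v \<in> carrier_vec (Suc m)" "v \<noteq> 0\<^sub>v (Suc m)" "A *\<^sub>v v = e \<cdot>\<^sub>v v"
    using real_symmetric_has_eigenvector[OF Suc.prems] by auto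
  (* In an orthonormal basis that begins with an eigenvector, A splits off a 1 x 1 block. *)
  obtain W c where W: "W \<in> carrier_mat (Suc m) (Suc m)" "transpose_mat W * W = 1\<^sub>m (Suc m)"
      "col W 0 = c \<cdot>\<^sub>v v"
    using orthogonal_matrix_first_column[OF v(1,2)] by auto
  note W' = orthogonal_mat_right_inverse[OF W(1,2)]
  define B where "B = transpose_mat W * A * W"
  have B: "B \<in> carrier_mat (Suc m) (Suc m)"
    using A W(1) by (auto simp: B_def)
  have B_sym: "transpose_mat B = B"
    using A W(1) Suc.prems(2)
    by (simp add: B_def transpose_mult[of _ "Suc m" "Suc m" _ "Suc m"] assoc_mult_mat[of _ "Suc m" "Suc m" _ "Suc m" _ "Suc m"])
  have AW: "A *\<^sub>v col W 0 = e \<cdot>\<^sub>v col W 0"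
    using A v by (simp add: W(3) mult_mat_vec smult_smult_assoc mult.commute)
  have "B $$ (i, 0) = 0" if "0 < i" "i < Suc m" for i
  proof -
    have "B $$ (i, 0) = col W i \<bullet> (A *\<^sub>v col W 0)"
      using A W(1) that 
      by (simp add: B_def mult_mat_vec_def assoc_mult_mat[of _ "Suc m" "Suc m" _ "Suc m" _ "Suc m"] col_mult2[of _ "Suc m" "Suc m" _ "Suc m"])
    also have "\<dots> = e * (transpose_mat W * W) $$ (i, 0)"
      using A W(1) that by (simp add: AW)
    finally show ?thesis
      using that by (simp add: W(2))
  qed
  then obtain B' where B': "B' \<in> carrier_mat m m" "transpose_mat B' = B'"
    "B = four_block_mat (mat 1 1 (\<lambda>_. B $$ (0, 0))) (0\<^sub>m 1 m) (0\<^sub>m m 1) B'"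
    using symmetric_split_first[OF B B_sym] by blast
  obtain U d where U: "U \<in> carrier_mat m m" "transpose_mat U * U = 1\<^sub>m m"
      "B' = U * mat_diag m d * transpose_mat U"
    using Suc.IH[OF B'(1,2)] by auto
  define V where "V = four_block_mat (1\<^sub>m 1) (0\<^sub>m 1 m) (0\<^sub>m m 1) U"
  define d' where "d' = case_nat (B $$ (0, 0)) d"
  have V: "V \<in> carrier_mat (Suc m) (Suc m)"
    using U(1) four_block_carrier_mat[of "1\<^sub>m 1" 1 1 U m m] by (simp add: V_def)
  have Vt: "transpose_mat V = four_block_mat (1\<^sub>m 1) (0\<^sub>m 1 m) (0\<^sub>m m 1) (transpose_mat U)"
    using U(1) by (simp add: V_def transpose_four_block_mat[of _ 1 1 _ m _ m])
  have D: "mat_diag (Suc m) d' =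
      four_block_mat (mat 1 1 (\<lambda>_. B $$ (0, 0))) (0\<^sub>m 1 m) (0\<^sub>m m 1) (mat_diag m d)"
    by (intro eq_matI) (auto simp: mat_diag_def d'_def four_block_mat_def Let_def split: nat.split)
  have VV: "transpose_mat V * V = 1\<^sub>m (Suc m)"
    unfolding Vt unfolding V_def
    using U by (subst mult_four_block_mat[of _ 1 1 _ m _ m _ _ 1 _ m]) (auto simp: four_block_one_mat)
  have B_eq: "B = V * mat_diag (Suc m) d' * transpose_mat V"
  proof -
    have "V * mat_diag (Suc m) d' =
        four_block_mat (mat 1 1 (\<lambda>_. B $$ (0, 0))) (0\<^sub>m 1 m) (0\<^sub>m m 1) (U * mat_diag m d)"
      unfolding D V_def using U(1)
      by (subst mult_four_block_mat[of _ 1 1 _ m _ m _ _ 1 _ m]) (auto simp: left_mult_zero_mat[OF mat_diag_dim])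
    then have "V * mat_diag (Suc m) d' * transpose_mat V =
        four_block_mat (mat 1 1 (\<lambda>_. B $$ (0, 0))) (0\<^sub>m 1 m) (0\<^sub>m m 1) (U * mat_diag m d * transpose_mat U)"
      unfolding Vt using U(1)
      by (simp, subst mult_four_block_mat[of _ 1 1 _ m _ m _ _ 1 _ m])
         (auto simp: right_mult_zero_mat[OF mult_carrier_mat[OF _ mat_diag_dim]]
            left_add_zero_mat[OF mult_carrier_mat[OF mult_carrier_mat[OF _ mat_diag_dim]]])
    then show ?thesis
      using B'(3) U(3) by simp
  qed
  have "A = W * B * transpose_mat W"
  proof -
    have "W * B * transpose_mat W = (W * transpose_mat W) * A * (W * transpose_mat W)"
      using A W(1) by (simp add: B_def assoc_mult_mat[of _ "Suc m" "Suc m" _ "Suc m" _ "Suc m"])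
    then show ?thesis
      using A by (simp add: W')
  qed
  then have "A = (W * V) * mat_diag (Suc m) d' * transpose_mat (W * V)"
    using W(1) V by (simp add: B_eq mat_diag_dim mult_carrier_mat[of _ "Suc m" "Suc m" _ "Suc m"]
      transpose_mult[of _ "Suc m" "Suc m" _ "Suc m"] assoc_mult_mat[of _ "Suc m" "Suc m" _ "Suc m" _ "Suc m"])
  moreover have "transpose_mat (W * V) * (W * V) = 1\<^sub>m (Suc m)"
  proof -
    have "transpose_mat (W * V) * (W * V) = transpose_mat V * (transpose_mat W * W) * V"
      using W(1) V by (simp add: transpose_mult[of _ "Suc m" "Suc m" _ "Suc m"] assoc_mult_mat[of _ "Suc m" "Suc m" _ "Suc m" _ "Suc m"])
    then show ?thesis
      using V VV by (simp add: W(2))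
  qed
  ultimately show ?case
    using W(1) V by (intro exI[of _ "W * V"] exI[of _ d']) auto
qed

lemma proots_linear_factors: "proots (\<Prod>a\<leftarrow>xs. [:- a, 1:]) = mset (xs :: 'a :: idom list)"
proof (induction xs)
  case (Cons a xs)
  have "(\<Prod>a\<leftarrow>xs. [:- a, 1:]) \<noteq> 0"
    by (auto simp: prod_list_zero_iff)
  then have "proots ([:- a, 1:] * (\<Prod>a\<leftarrow>xs. [:- a, 1:])) = proots [:- a, 1:] + mset xs"
    using Cons by (subst proots_mult) auto
  then show ?case
    by simp
qed simp

text \<open>
  The diagonal entries in the spectral theorem are the eigenvalues with the multiplicities that the
  characteristic polynomial gives them, because similar matrices have the same characteristic
  polynomial.
\<close>

lemma symmetric_diagonalization:
  fixes A :: "real mat"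
  assumes A: "A \<in> carrier_mat n n" "transpose_mat A = A"
  obtains U d where "U \<in> carrier_mat n n" "transpose_mat U * U = 1\<^sub>m n"
    "A = U * mat_diag n d * transpose_mat U" "eigenvalue_mset A = image_mset d (mset_set {..<n})"
proof -
  obtain U d where U: "U \<in> carrier_mat n n" "transpose_mat U * U = 1\<^sub>m n"
      "A = U * mat_diag n d * transpose_mat U"
    using real_spectral_theorem[OF A] by blast
  have "similar_mat_wit A (mat_diag n d) U (transpose_mat U)"
    using U A orthogonal_mat_right_inverse[OF U(1,2)] by (intro similar_mat_witI[of _ _ n]) auto
  then have "char_poly A = char_poly (mat_diag n d)"
    by (intro char_poly_similar) (auto simp: similar_mat_def)
  also have "\<dots> = (\<Prod>a\<leftarrow>map d [0..<n]. [:- a, 1:])"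
    by (subst char_poly_upper_triangular[of _ n])
       (auto simp: mat_diag_def diag_mat_def upper_triangular_def intro!: arg_cong[of _ _ prod_list])
  also have "proots \<dots> = image_mset d (mset_set {..<n})"
    by (subst proots_linear_factors) (simp add: lessThan_atLeast0 flip: mset_upt)
  finally have "eigenvalue_mset A = image_mset d (mset_set {..<n})"
    by (simp add: eigenvalue_mset_def)
  with U show thesis
    using that by blast
qed

section \<open>Monotonicity and Lipschitz dependence of eigenvalue sums\<close>

lemma mat_diag_mult_vec:
  fixes c :: "'a :: semiring_1 vec"
  assumes "c \<in> carrier_vec n"
  shows "mat_diag n d *\<^sub>v c = vec n (\<lambda>k. d k * c $ k)"
proof (rule eq_vecI)
  fix i assume "i < dim_vec (vec n (\<lambda>k. d k * c $ k))"
  then have i: "i < n"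
    by simp
  then have "(mat_diag n d *\<^sub>v c) $ i = (\<Sum>j<n. if j = i then d i * c $ i else 0)"
    using assms by (auto simp: mat_diag_def scalar_prod_def lessThan_atLeast0 simp del: sum.delta sum.delta'
        intro!: sum.cong)
  then show "(mat_diag n d *\<^sub>v c) $ i = vec n (\<lambda>k. d k * c $ k) $ i"
    using i by simp
qed (simp add: mat_diag_def)

lemma quadratic_form_diagonalization:
  fixes U :: "real mat"
  assumes U: "U \<in> carrier_mat n n" and v: "v \<in> carrier_vec n"
  shows "v \<bullet> ((U * mat_diag n d * transpose_mat U) *\<^sub>v v) = (\<Sum>k<n. d k * ((transpose_mat U *\<^sub>v v) $ k)\<^sup>2)"
proof -
  let ?c = "transpose_mat U *\<^sub>v v"
  have c: "?c \<in> carrier_vec n"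
    using U v by auto
  have "v \<bullet> ((U * mat_diag n d * transpose_mat U) *\<^sub>v v) = v \<bullet> (U *\<^sub>v (mat_diag n d *\<^sub>v ?c))"
    using U v by (simp add: assoc_mult_mat_vec[of _ n n _ n] mult_carrier_mat[OF U mat_diag_dim])
  also have "\<dots> = ?c \<bullet> (mat_diag n d *\<^sub>v ?c)"
    using U v mult_mat_vec_carrier[OF mat_diag_dim c] by (intro transpose_vec_mult_scalar[symmetric]) auto
  also have "mat_diag n d *\<^sub>v ?c = vec n (\<lambda>k. d k * ?c $ k)"
    by (rule mat_diag_mult_vec[OF c])
  also have "?c \<bullet> \<dots> = (\<Sum>k<n. d k * (?c $ k)\<^sup>2)"
    using c by (simp add: scalar_prod_def lessThan_atLeast0 power2_eq_square mult_ac)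
  finally show ?thesis .
qed

lemma orthogonal_mat_isometry:
  fixes U :: "real mat"
  assumes U: "U \<in> carrier_mat n n" "transpose_mat U * U = 1\<^sub>m n" and v: "v \<in> carrier_vec n"
  shows "(\<Sum>k<n. ((transpose_mat U *\<^sub>v v) $ k)\<^sup>2) = v \<bullet> v"
proof -
  have "U * mat_diag n (\<lambda>_. 1) * transpose_mat U = 1\<^sub>m n"
    using orthogonal_mat_right_inverse[OF U] U(1) by simp
  then show ?thesis
    using quadratic_form_diagonalization[OF U(1) v, of "\<lambda>_. 1"] v by simp
qed

text \<open>
  Padding the given vectors with zero rows to a square matrix gives determinant zero, hence a nonzero
  kernel vector.
\<close>

lemma nonzero_vec_orthogonal_to_few:
  fixes ws :: "real vec list"
  assumes ws: "set ws \<subseteq> carrier_vec n" "length ws < n"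
  obtains v where "v \<in> carrier_vec n" "v \<noteq> 0\<^sub>v n" "\<And>w. w \<in> set ws \<Longrightarrow> w \<bullet> v = 0"
proof -
  let ?k = "length ws"
  define c where "c = (\<lambda>i. if i < ?k then ws ! i else 0\<^sub>v n)"
  define M where "M = mat\<^sub>r n n (\<lambda>i. if i = ?k then 0\<^sub>v n else c i)"
  have c: "c i \<in> carrier_vec n" for i
    using ws(1) by (auto simp: c_def)
  have M: "M \<in> carrier_mat n n"
    by (simp add: M_def)
  have "Determinant.det M = 0"
    unfolding M_def using ws(2) c by (intro det_row_0) auto
  then obtain v where v: "v \<in> carrier_vec n" "v \<noteq> 0\<^sub>v n" "M *\<^sub>v v = 0\<^sub>v n"
    using det_0_iff_vec_prod_zero[OF M] by blast
  have "w \<bullet> v = 0" if w: "w \<in> set ws" for w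
  proof -
    obtain i where i: "i < ?k" "w = ws ! i"
      using w by (metis in_set_conv_nth)
    have "(M *\<^sub>v v) $ i = w \<bullet> v"
      using i ws c[of i] M v(1) by (simp add: M_def c_def)
    then show ?thesis
      using v(3) i ws(2) by simp
  qed
  with v show thesis
    using that by blast
qed

lemma size_filter_image_mset_lessThan:
  "size (filter_mset P (image_mset d (mset_set {..<n}))) = card {k\<in>{..<n}. P (d k)}" for n :: nat
proof -
  have "filter_mset P (image_mset d (mset_set {..<n})) =
      image_mset d (filter_mset (\<lambda>k. P (d k)) (mset_set {..<n}))"
    unfolding filter_mset_image_mset comp_def ..
  also have "filter_mset (\<lambda>k. P (d k)) (mset_set {..<n}) = mset_set {k\<in>{..<n}. P (d k)}"
    by (rule filter_mset_mset_set) simp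
  finally show ?thesis
    by (simp only: size_image_mset size_mset_set)
qed

text \<open>
  Weyl's monotonicity principle, by counting dimensions. If \<open>A\<close> had more eigenvalues above \<open>c\<close> than \<open>B\<close>,
  the span of the corresponding eigenvectors of \<open>A\<close> would meet the span of the eigenvectors of \<open>B\<close> with
  eigenvalues at most \<open>c\<close>. On a common nonzero vector \<open>v\<close> the form of \<open>A\<close> exceeds \<open>c |v|\<^sup>2\<close>, and that of
  \<open>B\<close> does not.
\<close>

lemma eigenvalue_count_mono:
  fixes A B :: "real mat"
  assumes A: "A \<in> carrier_mat n n" "transpose_mat A = A"
    and B: "B \<in> carrier_mat n n" "transpose_mat B = B"
    and le: "\<And>v. v \<in> carrier_vec n \<Longrightarrow> v \<bullet> (A *\<^sub>v v) \<le> v \<bullet> (B *\<^sub>v v)"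
  shows "size {#x \<in># eigenvalue_mset A. c < x#} \<le> size {#x \<in># eigenvalue_mset B. c < x#}"
proof (rule ccontr)
  obtain U d where U: "U \<in> carrier_mat n n" "transpose_mat U * U = 1\<^sub>m n"
      "A = U * mat_diag n d * transpose_mat U" "eigenvalue_mset A = image_mset d (mset_set {..<n})"
    using symmetric_diagonalization[OF A] by blast
  obtain V e where V: "V \<in> carrier_mat n n" "transpose_mat V * V = 1\<^sub>m n"
      "B = V * mat_diag n e * transpose_mat V" "eigenvalue_mset B = image_mset e (mset_set {..<n})"
    using symmetric_diagonalization[OF B] by blast
  let ?S = "{k\<in>{..<n}. \<not> c < d k}" and ?T = "{k\<in>{..<n}. c < e k}"
  (* A vector orthogonal to ws lies in the intersection of the two spans. *)
  define ws where "ws = map (col U) (sorted_list_of_set ?S) @ map (col V) (sorted_list_of_set ?T)"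
  assume "\<not> ?thesis"
  then have "card ?T < card {k\<in>{..<n}. c < d k}"
    by (simp add: U(4) V(4) size_filter_image_mset_lessThan)
  moreover have "card ?S + card {k\<in>{..<n}. c < d k} = n"
    by (subst card_Un_disjoint[symmetric]) (auto simp: Un_def intro!: arg_cong[of _ "{..<n}" card, simplified])
  ultimately have "length ws < n"
    by (simp add: ws_def)
  moreover have "set ws \<subseteq> carrier_vec n"
    using U(1) V(1) by (auto simp: ws_def)
  ultimately obtain v where v: "v \<in> carrier_vec n" "v \<noteq> 0\<^sub>v n" "\<And>w. w \<in> set ws \<Longrightarrow> w \<bullet> v = 0"
    using nonzero_vec_orthogonal_to_few[of ws n] by blast
  define a where "a = (\<lambda>k. (transpose_mat U *\<^sub>v v) $ k)"
  define b where "b = (\<lambda>k. (transpose_mat V *\<^sub>v v) $ k)"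
  have a0: "a k = 0" if "k < n" "\<not> c < d k" for k
    using that U(1) v(3)[of "col U k"] by (auto simp: a_def ws_def)
  have b0: "b k = 0" if "k < n" "c < e k" for k
    using that V(1) v(3)[of "col V k"] by (auto simp: b_def ws_def)
  have a2: "(\<Sum>k<n. (a k)\<^sup>2) = v \<bullet> v" and b2: "(\<Sum>k<n. (b k)\<^sup>2) = v \<bullet> v"
    using orthogonal_mat_isometry[OF U(1,2) v(1)] orthogonal_mat_isometry[OF V(1,2) v(1)]
    by (simp_all add: a_def b_def)
  have pos: "v \<bullet> v > 0"
    using v(1,2) conjugate_square_greater_0_vec[of v n] by simp
  have "\<exists>k<n. a k \<noteq> 0"
    using pos a2 by (metis (mono_tags, lifting) lessThan_iff less_irrefl power_zero_numeral sum.neutral)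
  then obtain k0 where k0: "k0 < n" "a k0 \<noteq> 0"
    by blast
  have "v \<bullet> (B *\<^sub>v v) = (\<Sum>k<n. e k * (b k)\<^sup>2)"
    using quadratic_form_diagonalization[OF V(1) v(1)] by (simp add: V(3) b_def)
  also have "\<dots> \<le> (\<Sum>k<n. c * (b k)\<^sup>2)"
  proof (rule sum_mono)
    fix k assume "k \<in> {..<n}"
    then show "e k * (b k)\<^sup>2 \<le> c * (b k)\<^sup>2"
      using b0[of k] by (cases "c < e k") (auto intro!: mult_right_mono)
  qed
  also have "\<dots> = (\<Sum>k<n. c * (a k)\<^sup>2)"
    by (simp add: a2 b2 flip: sum_distrib_left)
  also have "\<dots> < (\<Sum>k<n. d k * (a k)\<^sup>2)"
  proof (rule sum_strict_mono_ex1)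
    show "\<forall>k\<in>{..<n}. c * (a k)\<^sup>2 \<le> d k * (a k)\<^sup>2"
    proof
      fix k assume "k \<in> {..<n}"
      then show "c * (a k)\<^sup>2 \<le> d k * (a k)\<^sup>2"
        using a0[of k] by (cases "c < d k") (auto intro!: mult_right_mono)
    qed
    show "\<exists>k\<in>{..<n}. c * (a k)\<^sup>2 < d k * (a k)\<^sup>2"
      using k0 a0[of k0] by (intro bexI[of _ k0]) auto
  qed simp
  also have "\<dots> = v \<bullet> (A *\<^sub>v v)"
    using quadratic_form_diagonalization[OF U(1) v(1)] by (simp add: U(3) a_def)
  finally show False
    using le[OF v(1)] by simp
qed

text \<open>
  The hypothesis says that the sorted values of \<open>M\<close> are dominated one by one by the sorted values of
  \<open>N\<close>; the induction removes the two maxima.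
\<close>

lemma sum_mset_mono_counts:
  fixes M N :: "real multiset" and g :: "real \<Rightarrow> real"
  assumes "size M = size N"
    and "\<And>c. size {#x \<in># M. c < x#} \<le> size {#x \<in># N. c < x#}"
    and "mono g"
  shows "(\<Sum>x\<in>#M. g x) \<le> (\<Sum>x\<in>#N. g x)"
  using assms(1,2)
proof (induction "size M" arbitrary: M N)
  case 0
  then show ?case by simp
next
  case (Suc k)
  define a where "a = Max_mset M"
  define b where "b = Max_mset N"
  have nz: "M \<noteq> {#}" "N \<noteq> {#}"
    using Suc.hyps(2) Suc.prems(1) by auto
  obtain M' N' where M': "M = add_mset a M'" and N': "N = add_mset b N'"
    using nz by (metis Max_in a_def b_def finite_set_mset insert_DiffM set_mset_eq_empty_iff)
  have "x \<le> a" if "x \<in># M" for x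
    using that by (simp add: a_def)
  then have le_a: "x \<le> a" if "x \<in># M'" for x
    using that by (simp add: M')
  have "x \<le> b" if "x \<in># N" for x
    using that by (simp add: b_def)
  then have le_b: "x \<le> b" if "x \<in># N'" for x
    using that by (simp add: N')
  have "a \<le> b"
  proof (rule ccontr)
    assume "\<not> a \<le> b"
    have "size {#x \<in># M. b < x#} \<le> size {#x \<in># N. b < x#}"
      by (rule Suc.prems(2))
    moreover have "{#x \<in># N. b < x#} = {#}"
      using le_b by (force simp: N')
    ultimately show False
      using \<open>\<not> a \<le> b\<close> by (simp add: M' del: filter_mset_eq_mempty_iff)
  qed
  have "(\<Sum>x\<in>#M'. g x) \<le> (\<Sum>x\<in>#N'. g x)"
  proof (rule Suc.hyps(1))
    show "size {#x \<in># M'. c < x#} \<le> size {#x \<in># N'. c < x#}" for c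
    proof (cases "c < a")
      case True
      then show ?thesis
        using Suc.prems(2)[of c] \<open>a \<le> b\<close> by (simp add: M' N')
    next
      case False
      then have "{#x \<in># M'. c < x#} = {#}"
        using le_a by (force simp: filter_mset_eq_mempty_iff)
      then show ?thesis
        by (simp del: filter_mset_eq_mempty_iff)
    qed
  qed (use Suc in \<open>auto simp: M' N'\<close>)
  then show ?case
    using monoD[OF \<open>mono g\<close> \<open>a \<le> b\<close>] by (simp add: M' N')
qed

lemma size_eigenvalue_mset:
  fixes A :: "real mat"
  assumes "A \<in> carrier_mat n n" "transpose_mat A = A"
  shows "size (eigenvalue_mset A) = n"
proof -
  obtain d where "eigenvalue_mset A = image_mset d (mset_set {..<n})"
    using symmetric_diagonalization[OF assms] by blast
  then show ?thesis
    by simp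
qed

lemma sum_eigenvalue_mset:
  fixes A :: "real mat"
  assumes A: "A \<in> carrier_mat n n" "transpose_mat A = A"
  shows "(\<Sum>x\<in>#eigenvalue_mset A. x) = (\<Sum>i<n. A $$ (i, i))"
proof -
  obtain U d where U: "U \<in> carrier_mat n n" "transpose_mat U * U = 1\<^sub>m n"
      "A = U * mat_diag n d * transpose_mat U" "eigenvalue_mset A = image_mset d (mset_set {..<n})"
    using symmetric_diagonalization[OF A] by blast
  have "A $$ (i, i) = (\<Sum>k<n. d k * (U $$ (i, k))\<^sup>2)" if "i < n" for i
    using that U(1) unfolding U(3) mat_diag_mult_right[OF U(1)]
    by (simp add: scalar_prod_def lessThan_atLeast0 power2_eq_square mult_ac)
  then have "(\<Sum>i<n. A $$ (i, i)) = (\<Sum>i<n. \<Sum>k<n. d k * (U $$ (i, k))\<^sup>2)"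
    by simp
  also have "\<dots> = (\<Sum>k<n. d k * (\<Sum>i<n. (U $$ (i, k))\<^sup>2))"
    by (subst sum.swap) (simp add: sum_distrib_left)
  also have "\<dots> = (\<Sum>k<n. d k)"
  proof (rule sum.cong)
    fix k assume k: "k \<in> {..<n}"
    have "(transpose_mat U * U) $$ (k, k) = (\<Sum>i<n. (U $$ (i, k))\<^sup>2)"
      using U(1) k by (simp add: scalar_prod_def lessThan_atLeast0 power2_eq_square)
    then show "d k * (\<Sum>i<n. (U $$ (i, k))\<^sup>2) = d k"
      using k by (simp add: U(2))
  qed simp
  finally show ?thesis
    by (simp add: U(4) sum_unfold_sum_mset)
qed

text \<open>
  When \<open>A\<close> lies below \<open>B\<close> in the Loewner order, the sum of any increasing function over the eigenvalues
  increases from \<open>A\<close> to \<open>B\<close>. An \<open>L\<close>-Lipschitz function \<open>f\<close> is controlled by the increasing functions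
  \<open>L x + f x\<close> and \<open>L x - f x\<close>, and the sum of \<open>L x\<close> over the eigenvalues is \<open>L\<close> times the trace.
\<close>

lemma eigenvalue_sum_lipschitz_loewner:
  fixes A B :: "real mat" and f :: "real \<Rightarrow> real"
  assumes A: "A \<in> carrier_mat n n" "transpose_mat A = A"
    and B: "B \<in> carrier_mat n n" "transpose_mat B = B"
    and le: "\<And>v. v \<in> carrier_vec n \<Longrightarrow> v \<bullet> (A *\<^sub>v v) \<le> v \<bullet> (B *\<^sub>v v)"
    and f: "L-lipschitz_on UNIV f"
  shows "\<bar>(\<Sum>x\<in>#eigenvalue_mset A. f x) - (\<Sum>x\<in>#eigenvalue_mset B. f x)\<bar>
    \<le> L * (\<Sum>i<n. B $$ (i, i) - A $$ (i, i))"
proof -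
  have mono: "(\<Sum>x\<in>#eigenvalue_mset A. g x) \<le> (\<Sum>x\<in>#eigenvalue_mset B. g x)" if "mono g" for g :: "real \<Rightarrow> real"
    using that eigenvalue_count_mono[OF A B le] size_eigenvalue_mset[OF A] size_eigenvalue_mset[OF B]
    by (intro sum_mset_mono_counts) auto
  have lip: "\<bar>f x - f y\<bar> \<le> L * \<bar>x - y\<bar>" for x y
    using lipschitz_onD[OF f, of x y] by (simp add: dist_real_def)
  have "f x - f y \<le> L * y - L * x \<and> f y - f x \<le> L * y - L * x" if "x \<le> y" for x y
    using lip[of x y] that by (auto simp: right_diff_distrib abs_le_iff)
  then have "mono (\<lambda>x. L * x + f x)" "mono (\<lambda>x. L * x - f x)"
    by (smt (verit) mono_on_def)+
  note le = this[THEN mono]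
  have split: "(\<Sum>x\<in>#M. L * x + f x) = L * (\<Sum>x\<in>#M. x) + (\<Sum>x\<in>#M. f x)"
     "(\<Sum>x\<in>#M. L * x - f x) = L * (\<Sum>x\<in>#M. x) - (\<Sum>x\<in>#M. f x)" for M
    by (induction M) (simp_all add: algebra_simps)
  have "\<bar>(\<Sum>x\<in>#eigenvalue_mset A. f x) - (\<Sum>x\<in>#eigenvalue_mset B. f x)\<bar>
      \<le> L * (\<Sum>x\<in>#eigenvalue_mset B. x) - L * (\<Sum>x\<in>#eigenvalue_mset A. x)"
    using le unfolding split by linarith
  then show ?thesis
    unfolding sum_eigenvalue_mset[OF A] sum_eigenvalue_mset[OF B]
    by (simp add: sum_subtractf right_diff_distrib)
qed

lemma quadratic_form_eq_sum:
  fixes A :: "real mat"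
  assumes "A \<in> carrier_mat n n" "v \<in> carrier_vec n"
  shows "v \<bullet> (A *\<^sub>v v) = (\<Sum>i<n. \<Sum>j<n. A $$ (i, j) * v $ i * v $ j)"
  using assms by (simp add: scalar_prod_def lessThan_atLeast0 sum_distrib_left mult_ac)

text \<open>
  Two matrices that are not comparable are compared with a common upper bound. Let \<open>D\<close> be the diagonal
  matrix of the row sums of \<open>|A - B|\<close>. Then \<open>D + (A - B)\<close> and \<open>D - (A - B)\<close> are diagonally dominant, hence
  positive semidefinite, so \<open>C = (A + B + D) / 2\<close> lies above both \<open>A\<close> and \<open>B\<close>, and the traces of \<open>C - A\<close>
  and \<open>C - B\<close> add up to the trace of \<open>D\<close>, which is the entrywise distance.
\<close>

lemma eigenvalue_sum_lipschitz_l1: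
  fixes A B :: "real mat" and f :: "real \<Rightarrow> real"
  assumes A: "A \<in> carrier_mat n n" "transpose_mat A = A"
    and B: "B \<in> carrier_mat n n" "transpose_mat B = B"
    and f: "L-lipschitz_on UNIV f"
  shows "\<bar>(\<Sum>x\<in>#eigenvalue_mset A. f x) - (\<Sum>x\<in>#eigenvalue_mset B. f x)\<bar>
    \<le> L * (\<Sum>i<n. \<Sum>j<n. \<bar>A $$ (i, j) - B $$ (i, j)\<bar>)"
proof -
  define D where "D = (\<lambda>i j. \<bar>A $$ (i, j) - B $$ (i, j)\<bar>)"
  define r where "r = (\<lambda>i. \<Sum>j<n. D i j)"
  define C where "C = mat n n (\<lambda>(i, j). (A $$ (i, j) + B $$ (i, j) + (if i = j then r i else 0)) / 2)"
  have symA: "A $$ (i, j) = A $$ (j, i)" and symB: "B $$ (i, j) = B $$ (j, i)" if "i < n" "j < n" for i j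
    using arg_cong[OF A(2), of "\<lambda>M. M $$ (i, j)"] arg_cong[OF B(2), of "\<lambda>M. M $$ (i, j)"] A(1) B(1) that
    by simp_all
  have C: "C \<in> carrier_mat n n" "transpose_mat C = C"
    using symA symB by (auto simp: C_def intro!: eq_matI)
  (* Applied to M = A and to M = B; then q is B - A or A - B, which D dominates entrywise. *)
  have psd: "v \<bullet> (M *\<^sub>v v) \<le> v \<bullet> (C *\<^sub>v v)"
    if M: "M \<in> carrier_mat n n" "\<And>i j. i < n \<Longrightarrow> j < n \<Longrightarrow> \<bar>A $$ (i, j) + B $$ (i, j) - 2 * M $$ (i, j)\<bar> \<le> D i j"
      and v: "v \<in> carrier_vec n" for M v
  proof -
    define q where "q = (\<lambda>i j. A $$ (i, j) + B $$ (i, j) - 2 * M $$ (i, j))"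
    have "- (\<Sum>i<n. \<Sum>j<n. q i j * v $ i * v $ j) \<le> (\<Sum>i<n. \<Sum>j<n. D i j * ((v $ i)\<^sup>2 + (v $ j)\<^sup>2) / 2)"
      unfolding sum_negf[symmetric]
    proof (intro sum_mono)
      fix i j assume ij: "i \<in> {..<n}" "j \<in> {..<n}"
      have "- (q i j * v $ i * v $ j) \<le> \<bar>q i j\<bar> * (\<bar>v $ i\<bar> * \<bar>v $ j\<bar>)"
        by (metis abs_ge_minus_self abs_mult mult.assoc)
      also have "\<dots> \<le> D i j * (((v $ i)\<^sup>2 + (v $ j)\<^sup>2) / 2)"
      proof (intro mult_mono)
        show "\<bar>q i j\<bar> \<le> D i j"
          using M(2) ij by (simp add: q_def)
        show "\<bar>v $ i\<bar> * \<bar>v $ j\<bar> \<le> ((v $ i)\<^sup>2 + (v $ j)\<^sup>2) / 2"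
          using sum_squares_bound[of "\<bar>v $ i\<bar>" "\<bar>v $ j\<bar>"] by simp
      qed (auto simp: D_def)
      finally show "- (q i j * v $ i * v $ j) \<le> D i j * ((v $ i)\<^sup>2 + (v $ j)\<^sup>2) / 2"
        by simp
    qed
    also have "\<dots> = (\<Sum>i<n. \<Sum>j<n. D i j * (v $ i)\<^sup>2) / 2 + (\<Sum>i<n. \<Sum>j<n. D i j * (v $ j)\<^sup>2) / 2"
      by (simp add: sum.distrib sum_divide_distrib distrib_left add_divide_distrib)
    also have "(\<Sum>i<n. \<Sum>j<n. D i j * (v $ j)\<^sup>2) = (\<Sum>i<n. \<Sum>j<n. D i j * (v $ i)\<^sup>2)"
      by (subst sum.swap) (auto simp: D_def symA symB intro!: sum.cong)
    finally have *: "- (\<Sum>i<n. \<Sum>j<n. q i j * v $ i * v $ j) \<le> (\<Sum>i<n. r i * (v $ i)\<^sup>2)"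
      by (simp add: r_def sum_distrib_right)
    have "2 * (v \<bullet> (C *\<^sub>v v)) = (\<Sum>i<n. \<Sum>j<n. 2 * M $$ (i, j) * v $ i * v $ j + q i j * v $ i * v $ j
        + (if j = i then r i * (v $ i)\<^sup>2 else 0))"
      unfolding quadratic_form_eq_sum[OF C(1) v] sum_distrib_left
      by (intro sum.cong) (auto simp: C_def q_def algebra_simps power2_eq_square)
    also have "\<dots> = 2 * (v \<bullet> (M *\<^sub>v v)) + (\<Sum>i<n. \<Sum>j<n. q i j * v $ i * v $ j) + (\<Sum>i<n. r i * (v $ i)\<^sup>2)"
      unfolding quadratic_form_eq_sum[OF M(1) v]
      by (simp add: sum.distrib sum_distrib_left mult.assoc)
    finally show ?thesis
      using * by simp
  qed
  have le: "\<And>v. v \<in> carrier_vec n \<Longrightarrow> v \<bullet> (A *\<^sub>v v) \<le> v \<bullet> (C *\<^sub>v v)"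
      "\<And>v. v \<in> carrier_vec n \<Longrightarrow> v \<bullet> (B *\<^sub>v v) \<le> v \<bullet> (C *\<^sub>v v)"
    using psd[OF A(1)] psd[OF B(1)] by (auto simp: D_def)
  have "\<bar>(\<Sum>x\<in>#eigenvalue_mset A. f x) - (\<Sum>x\<in>#eigenvalue_mset B. f x)\<bar>
      \<le> L * (\<Sum>i<n. C $$ (i, i) - A $$ (i, i)) + L * (\<Sum>i<n. C $$ (i, i) - B $$ (i, i))"
    using eigenvalue_sum_lipschitz_loewner[OF A C le(1) f] eigenvalue_sum_lipschitz_loewner[OF B C le(2) f]
    by linarith
  also have "\<dots> = L * (\<Sum>i<n. (C $$ (i, i) - A $$ (i, i)) + (C $$ (i, i) - B $$ (i, i)))"
    by (simp only: sum.distrib distrib_left)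
  also have "(\<Sum>i<n. (C $$ (i, i) - A $$ (i, i)) + (C $$ (i, i) - B $$ (i, i))) = (\<Sum>i<n. r i)"
    by (intro sum.cong) (auto simp: C_def field_simps)
  finally show ?thesis
    by (simp add: r_def D_def)
qed

section \<open>Variance of Lipschitz functions of independent variables\<close>

text \<open>
  The bound makes \<open>F\<close> continuous for the product topology on the space of all functions. As the index
  type is countable, the Borel sets of this topology are those of the product \<open>\<sigma>\<close>-algebra, and \<open>F\<close>
  depends on the coordinates in \<open>I\<close> only.
\<close>

lemma l1_lipschitz_measurable:
  fixes F :: "('i::countable \<Rightarrow> real) \<Rightarrow> real"
  assumes lip: "\<And>x y. \<bar>F x - F y\<bar> \<le> C * (\<Sum>i\<in>I. \<bar>x i - y i\<bar>)"
  shows "F \<in> borel_measurable (Pi\<^sub>M I (\<lambda>_. borel))"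
proof -
  have "continuous_on UNIV F"
    unfolding continuous_on_def
  proof
    fix x :: "'i \<Rightarrow> real"
    have "((\<lambda>y :: 'i \<Rightarrow> real. y i) \<longlongrightarrow> x i) (at x)" for i
      using continuous_on_product_coordinates[of i] unfolding continuous_on_def by auto
    then have "((\<lambda>y. C * (\<Sum>i\<in>I. \<bar>y i - x i\<bar>)) \<longlongrightarrow> C * (\<Sum>i\<in>I. \<bar>x i - x i\<bar>)) (at x)"
      by (intro tendsto_intros)
    then have lim: "((\<lambda>y. C * (\<Sum>i\<in>I. \<bar>y i - x i\<bar>)) \<longlongrightarrow> 0) (at x)"
      by simp
    have "\<forall>\<^sub>F y in at x. norm (F y - F x) \<le> C * (\<Sum>i\<in>I. \<bar>y i - x i\<bar>)"
      unfolding real_norm_def by (intro always_eventually allI lip)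
    from Lim_null_comparison[OF this lim] have "((\<lambda>y. F y - F x) \<longlongrightarrow> 0) (at x)" .
    then show "(F \<longlongrightarrow> F x) (at x within UNIV)"
      by (simp add: LIM_zero_iff)
  qed
  then have "F \<in> borel_measurable borel"
    by (rule borel_measurable_continuous_onI)
  then have F: "F \<in> borel_measurable (Pi\<^sub>M UNIV (\<lambda>_. borel))"
    using measurable_cong_sets[OF sets_PiM_equal_borel refl] by blast
  have "(\<lambda>x i. if i \<in> I then x i else 0) \<in> Pi\<^sub>M I (\<lambda>_. borel) \<rightarrow>\<^sub>M Pi\<^sub>M UNIV (\<lambda>_. borel :: real measure)"
  proof (rule measurable_PiM_single')
    show "(\<lambda>x. if i \<in> I then x i else 0) \<in> Pi\<^sub>M I (\<lambda>_. borel) \<rightarrow>\<^sub>M (borel :: real measure)" for i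
      by (cases "i \<in> I") auto
  qed auto
  from measurable_compose[OF this F]
  have "(\<lambda>x. F (\<lambda>i. if i \<in> I then x i else 0)) \<in> borel_measurable (Pi\<^sub>M I (\<lambda>_. borel))" .
  moreover have "F (\<lambda>i. if i \<in> I then x i else 0) = F x" for x
    using lip[of "\<lambda>i. if i \<in> I then x i else 0" x] by simp
  ultimately show ?thesis
    by simp
qed

lemma (in prob_space) expectation_square_shift:
  fixes f :: "'a \<Rightarrow> real"
  assumes f: "f \<in> borel_measurable M" "integrable M (\<lambda>x. (f x)\<^sup>2)"
  shows "expectation (\<lambda>x. (f x - a)\<^sup>2) = expectation (\<lambda>x. (f x - expectation f)\<^sup>2) + (expectation f - a)\<^sup>2"
proof -
  have int: "integrable M f"
    using square_integrable_imp_integrable[OF f] .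
  have shift: "expectation (\<lambda>x. (f x - b)\<^sup>2) = expectation (\<lambda>x. (f x)\<^sup>2) - 2 * b * expectation f + b\<^sup>2" for b
  proof -
    have "expectation (\<lambda>x. (f x - b)\<^sup>2) = expectation (\<lambda>x. (f x)\<^sup>2 - 2 * b * f x + b\<^sup>2)"
      by (rule Bochner_Integration.integral_cong) (auto simp: power2_eq_square algebra_simps)
    also have "\<dots> = expectation (\<lambda>x. (f x)\<^sup>2) - 2 * b * expectation f + b\<^sup>2"
      using int f(2) by (simp add: prob_space)
    finally show ?thesis .
  qed
  show ?thesis
    unfolding shift[of a] shift[of "expectation f"] by (simp add: power2_eq_square algebra_simps)
qed

lemma integrable_between:
  fixes f g :: "'a \<Rightarrow> real"
  assumes "integrable M g" "f \<in> borel_measurable M" "\<And>x. 0 \<le> f x" "\<And>x. f x \<le> g x"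
  shows "integrable M f"
  using assms(1,2)
proof (rule Bochner_Integration.integrable_bound)
  show "AE x in M. norm (f x) \<le> norm (g x)"
    proof (rule AE_I2)
    fix x
    have "norm (f x) = f x"
      using assms(3) by simp
    also have "\<dots> \<le> norm (g x)"
      using assms(4)[of x] unfolding real_norm_def by linarith
    finally show "norm (f x) \<le> norm (g x)" .
  qed
qed

lemma square_le_shifted: "b\<^sup>2 \<le> 2 * a\<^sup>2 + 2 * (b - a)\<^sup>2" for a b :: real
  using zero_le_power2[of "b - 2 * a"] by (simp add: power2_eq_square algebra_simps)

lemma lipschitz_square_integrable:
  fixes h :: "real \<Rightarrow> real"
  assumes "prob_space \<nu>" "sets \<nu> = sets borel" "integrable \<nu> (\<lambda>y. y\<^sup>2)"
    and lip: "\<And>y z. \<bar>h y - h z\<bar> \<le> C * \<bar>y - z\<bar>"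
  shows "h \<in> borel_measurable \<nu>" "integrable \<nu> (\<lambda>y. (h y)\<^sup>2)"
proof -
  interpret prob_space \<nu> by fact
  have "C \<ge> 0"
    using lip[of 0 1] by simp
  then have "C-lipschitz_on UNIV h"
    using lip by (intro lipschitz_onI) (auto simp: dist_real_def)
  then have "h \<in> borel_measurable borel"
    by (intro borel_measurable_continuous_onI lipschitz_on_continuous_on)
  then show h: "h \<in> borel_measurable \<nu>"
    using measurable_cong_sets[OF assms(2) refl] by blast
  have bound: "(h y)\<^sup>2 \<le> 2 * (h 0)\<^sup>2 + 2 * C\<^sup>2 * y\<^sup>2" for y
  proof -
    have "\<bar>h y - h 0\<bar>\<^sup>2 \<le> (C * \<bar>y\<bar>)\<^sup>2"
      using lip[of y 0] by (intro power_mono) auto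
    moreover have "(h y)\<^sup>2 \<le> 2 * (h 0)\<^sup>2 + 2 * (h y - h 0)\<^sup>2"
      by (rule square_le_shifted)
    ultimately show ?thesis
      by (simp add: power_mult_distrib)
  qed
  show "integrable \<nu> (\<lambda>y. (h y)\<^sup>2)"
  proof (rule integrable_between)
    show "integrable \<nu> (\<lambda>y. 2 * (h 0)\<^sup>2 + 2 * C\<^sup>2 * y\<^sup>2)"
      using assms(3) by (intro Bochner_Integration.integrable_add integrable_mult_right) simp_all
    show "(\<lambda>y. (h y)\<^sup>2) \<in> borel_measurable \<nu>"
      using h by measurable
    show "0 \<le> (h y)\<^sup>2" for y
      by simp
  qed (rule bound)
qed

text \<open>
  The mean is the best constant approximation in mean square, so that it may be replaced by \<open>h 0\<close>.
\<close>

lemma lipschitz_variance_le: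
  fixes h :: "real \<Rightarrow> real"
  assumes \<nu>: "prob_space \<nu>" "sets \<nu> = sets borel" "integrable \<nu> (\<lambda>y. y\<^sup>2)"
    and lip: "\<And>y z. \<bar>h y - h z\<bar> \<le> C * \<bar>y - z\<bar>"
  shows "(\<integral>y. (h y - (\<integral>z. h z \<partial>\<nu>))\<^sup>2 \<partial>\<nu>) \<le> C\<^sup>2 * (\<integral>y. y\<^sup>2 \<partial>\<nu>)"
proof -
  interpret prob_space \<nu> by fact
  have "(\<integral>y. (h y - (\<integral>z. h z \<partial>\<nu>))\<^sup>2 \<partial>\<nu>) \<le> (\<integral>y. (h y - h 0)\<^sup>2 \<partial>\<nu>)"
    using expectation_square_shift[OF lipschitz_square_integrable[OF \<nu> lip], of "h 0"] by simp
  also have "\<dots> \<le> (\<integral>y. C\<^sup>2 * y\<^sup>2 \<partial>\<nu>)"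
  proof (rule integral_mono')
    show "(h y - h 0)\<^sup>2 \<le> C\<^sup>2 * y\<^sup>2" for y
      using power_mono[OF lip[of y 0], of 2] by (simp add: power_mult_distrib)
  qed (use \<nu> in auto)
  finally show ?thesis by simp
qed

lemma l1_lipschitz_square_integrable:
  fixes F :: "('i::countable \<Rightarrow> real) \<Rightarrow> real"
  assumes \<nu>: "prob_space \<nu>" "sets \<nu> = sets borel" "integrable \<nu> (\<lambda>y. y\<^sup>2)"
    and I: "finite I"
    and lip: "\<And>x y. \<bar>F x - F y\<bar> \<le> C * (\<Sum>i\<in>I. \<bar>x i - y i\<bar>)"
  shows "F \<in> borel_measurable (Pi\<^sub>M I (\<lambda>_. \<nu>))" "integrable (Pi\<^sub>M I (\<lambda>_. \<nu>)) (\<lambda>x. (F x)\<^sup>2)"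
proof -
  interpret \<nu>: prob_space \<nu> by fact
  interpret P: product_prob_space "\<lambda>_. \<nu>" I ..
  have sets_P: "sets (Pi\<^sub>M I (\<lambda>_. \<nu>)) = sets (Pi\<^sub>M I (\<lambda>_. borel :: real measure))"
    by (rule sets_PiM_cong) (simp_all add: \<nu>(2))
  show F: "F \<in> borel_measurable (Pi\<^sub>M I (\<lambda>_. \<nu>))"
    unfolding measurable_cong_sets[OF sets_P refl] by (rule l1_lipschitz_measurable[OF lip])
  have coord: "integrable (Pi\<^sub>M I (\<lambda>_. \<nu>)) (\<lambda>x. (x i)\<^sup>2)" if "i \<in> I" for i
  proof -
    have "distr (Pi\<^sub>M I (\<lambda>_. \<nu>)) \<nu> (\<lambda>x. x i) = \<nu>"
      using P.PiM_component that by simp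
    then show ?thesis
      using that \<nu>(3) integrable_distr[of "\<lambda>x. x i" "Pi\<^sub>M I (\<lambda>_. \<nu>)" \<nu> "\<lambda>y. y\<^sup>2"]
      by (simp add: measurable_component_singleton)
  qed
  have bound: "(F x)\<^sup>2 \<le> 2 * (F (\<lambda>_. 0))\<^sup>2 + 2 * C\<^sup>2 * (card I * (\<Sum>i\<in>I. (x i)\<^sup>2))" for x :: "'i \<Rightarrow> real"
  proof -
    have "\<bar>F x - F (\<lambda>_. 0)\<bar>\<^sup>2 \<le> (C * (\<Sum>i\<in>I. \<bar>x i\<bar>))\<^sup>2"
      using lip[of x "\<lambda>_. 0"] by (intro power_mono) auto
    also have "\<dots> = C\<^sup>2 * (\<Sum>i\<in>I. \<bar>x i\<bar>)\<^sup>2"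
      by (simp add: power_mult_distrib)
    also have "\<dots> \<le> C\<^sup>2 * (card I * (\<Sum>i\<in>I. (x i)\<^sup>2))"
      using sum_squared_le_sum_of_squares[of "\<lambda>i. \<bar>x i\<bar>"] by (intro mult_left_mono) (auto simp: mult.commute)
    finally have "\<bar>F x - F (\<lambda>_. 0)\<bar>\<^sup>2 \<le> C\<^sup>2 * (card I * (\<Sum>i\<in>I. (x i)\<^sup>2))" .
    moreover have "(F x)\<^sup>2 \<le> 2 * (F (\<lambda>_. 0))\<^sup>2 + 2 * (F x - F (\<lambda>_. 0))\<^sup>2"
      by (rule square_le_shifted)
    ultimately show ?thesis
      by simp
  qed
  show "integrable (Pi\<^sub>M I (\<lambda>_. \<nu>)) (\<lambda>x. (F x)\<^sup>2)"
  proof (rule integrable_between)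
    show "integrable (Pi\<^sub>M I (\<lambda>_. \<nu>)) (\<lambda>x. 2 * (F (\<lambda>_. 0))\<^sup>2 + 2 * C\<^sup>2 * (card I * (\<Sum>i\<in>I. (x i)\<^sup>2)))"
      using coord by (intro Bochner_Integration.integrable_add integrable_mult_right Bochner_Integration.integrable_sum) simp_all
    show "(\<lambda>x. (F x)\<^sup>2) \<in> borel_measurable (Pi\<^sub>M I (\<lambda>_. \<nu>))"
      using F by measurable
    show "0 \<le> (F x)\<^sup>2" for x
      by simp
  qed (rule bound)
qed

text \<open>
  An Efron-Stein inequality: each independent coordinate contributes at most its own Lipschitz variance.
  Integrating out a new coordinate \<open>i\<close> turns \<open>F\<close> into a function \<open>H\<close> of the other coordinates with the
  same mean and the same Lipschitz constant. By Pythagoras, the mean square deviation of \<open>F\<close> from any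
  constant, for fixed other coordinates, is that of \<open>H\<close> plus the variance in the coordinate \<open>i\<close>.
\<close>

lemma l1_lipschitz_variance_le:
  fixes F :: "('i::countable \<Rightarrow> real) \<Rightarrow> real"
  assumes \<nu>: "prob_space \<nu>" "sets \<nu> = sets borel" "integrable \<nu> (\<lambda>y. y\<^sup>2)"
    and I: "finite I"
    and lip: "\<And>x y. \<bar>F x - F y\<bar> \<le> C * (\<Sum>i\<in>I. \<bar>x i - y i\<bar>)"
  shows "(\<integral>x. (F x - (\<integral>x. F x \<partial>Pi\<^sub>M I (\<lambda>_. \<nu>)))\<^sup>2 \<partial>Pi\<^sub>M I (\<lambda>_. \<nu>)) \<le> card I * (C\<^sup>2 * (\<integral>y. y\<^sup>2 \<partial>\<nu>))"
  using I lip
proof (induction I arbitrary: F)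
  case empty
  interpret \<nu>: prob_space \<nu> by fact
  interpret P: product_prob_space "\<lambda>_. \<nu>" "{} :: 'i set" ..
  have "F x = F (\<lambda>_. 0)" for x
    using empty.prems[of x "\<lambda>_. 0"] by simp
  then have F: "F = (\<lambda>x. F (\<lambda>_. 0))" ..
  show ?case
    by (subst (1 2) F) (simp add: P.P.prob_space)
next
  case (insert i I)
  interpret \<nu>: prob_space \<nu> by fact
  interpret P: product_prob_space "\<lambda>_. \<nu>" I ..
  interpret P': product_prob_space "\<lambda>_. \<nu>" "insert i I" ..
  let ?P = "Pi\<^sub>M I (\<lambda>_. \<nu>)" and ?P' = "Pi\<^sub>M (insert i I) (\<lambda>_. \<nu>)"
  define H where "H = (\<lambda>x. \<integral>y. F (x(i := y)) \<partial>\<nu>)"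
  define m where "m = (\<integral>x. F x \<partial>?P')"
  have lip_i: "\<bar>F (x(i := y)) - F (x(i := z))\<bar> \<le> C * \<bar>y - z\<bar>" for x y z
  proof -
    have "(\<Sum>j\<in>I. \<bar>(x(i := y)) j - (x(i := z)) j\<bar>) = 0"
      by (rule sum.neutral) (use insert.hyps in auto)
    then have "(\<Sum>j\<in>insert i I. \<bar>(x(i := y)) j - (x(i := z)) j\<bar>) = \<bar>y - z\<bar>"
      using insert.hyps by (simp del: fun_upd_apply add: fun_upd_same)
    then show ?thesis
      using insert.prems[of "x(i := y)" "x(i := z)"] by (simp del: fun_upd_apply)
  qed
  note slice = lipschitz_square_integrable[OF \<nu> lip_i]
  have section_int: "integrable \<nu> (\<lambda>y. F (x(i := y)))" for x
    using \<nu>.square_integrable_imp_integrable[OF slice] .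
  have lip_H: "\<bar>H x - H x'\<bar> \<le> C * (\<Sum>j\<in>I. \<bar>x j - x' j\<bar>)" for x x'
  proof -
    have bound: "\<bar>F (x(i := y)) - F (x'(i := y))\<bar> \<le> C * (\<Sum>j\<in>I. \<bar>x j - x' j\<bar>)" for y
    proof -
      have "(\<Sum>j\<in>insert i I. \<bar>(x(i := y)) j - (x'(i := y)) j\<bar>) = (\<Sum>j\<in>I. \<bar>x j - x' j\<bar>)"
        using insert.hyps by (auto intro!: sum.cong)
      then show ?thesis
        using insert.prems[of "x(i := y)" "x'(i := y)"] by (simp del: fun_upd_apply)
    qed
    have "\<bar>H x - H x'\<bar> = \<bar>\<integral>y. F (x(i := y)) - F (x'(i := y)) \<partial>\<nu>\<bar>"
      by (simp add: H_def section_int)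
    also have "\<dots> \<le> (\<integral>y. \<bar>F (x(i := y)) - F (x'(i := y))\<bar> \<partial>\<nu>)"
      using integral_abs_bound by blast
    also have "\<dots> \<le> (\<integral>y. C * (\<Sum>j\<in>I. \<bar>x j - x' j\<bar>) \<partial>\<nu>)"
      by (intro integral_mono bound) (auto simp: section_int)
    finally show ?thesis
      by (simp add: \<nu>.prob_space)
  qed
  note sq = l1_lipschitz_square_integrable[OF \<nu> _ insert.prems, OF finite.insertI[OF insert.hyps(1)]]
  note sq_H = l1_lipschitz_square_integrable[OF \<nu> insert.hyps(1) lip_H]
  have int: "integrable ?P' F"
    using P'.square_integrable_imp_integrable[OF sq] .
  have int_H: "integrable ?P H"
    using P.square_integrable_imp_integrable[OF sq_H] .
  have mean_H: "(\<integral>x. H x \<partial>?P) = m"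
    unfolding m_def H_def
    by (rule P.product_integral_insert[symmetric]) (use insert.hyps int in auto)
  have "(\<integral>x. (F x - m)\<^sup>2 \<partial>?P') = (\<integral>x. (\<integral>y. (F (x(i := y)) - m)\<^sup>2 \<partial>\<nu>) \<partial>?P)"
    by (rule P.product_integral_insert) (use insert.hyps int sq in \<open>auto simp: power2_diff\<close>)
  also have "\<dots> \<le> (\<integral>x. C\<^sup>2 * (\<integral>y. y\<^sup>2 \<partial>\<nu>) + (H x - m)\<^sup>2 \<partial>?P)"
  proof (rule integral_mono')
    show "integrable ?P (\<lambda>x. C\<^sup>2 * (\<integral>y. y\<^sup>2 \<partial>\<nu>) + (H x - m)\<^sup>2)"
      using sq_H int_H by (simp add: power2_diff)
    show "(\<integral>y. (F (x(i := y)) - m)\<^sup>2 \<partial>\<nu>) \<le> C\<^sup>2 * (\<integral>y. y\<^sup>2 \<partial>\<nu>) + (H x - m)\<^sup>2" for x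
      using \<nu>.expectation_square_shift[OF slice, of x m] lipschitz_variance_le[OF \<nu> lip_i, of x]
      by (simp add: H_def)
  qed auto
  also have "\<dots> = C\<^sup>2 * (\<integral>y. y\<^sup>2 \<partial>\<nu>) + (\<integral>x. (H x - m)\<^sup>2 \<partial>?P)"
    using sq_H int_H by (simp add: power2_diff P.P.prob_space)
  also have "(\<integral>x. (H x - m)\<^sup>2 \<partial>?P) \<le> card I * (C\<^sup>2 * (\<integral>y. y\<^sup>2 \<partial>\<nu>))"
    using insert.IH[of H, OF lip_H] by (simp add: mean_H)
  finally show ?case
    using insert.hyps by (simp add: m_def algebra_simps)
qed

section \<open>Concentration of the empirical law of eigenvalues\<close>

text \<open>
  The empirical law is the image of the uniform distribution on the indices of the eigenvalues.
\<close>

lemma integral_empirical_law: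
  assumes X: "X \<in> carrier_mat n n" "transpose_mat X = X" and n: "n \<ge> 1"
    and f: "f \<in> borel_measurable borel"
  shows "(\<integral>x. f x \<partial>empirical_law X) = (\<Sum>x\<in>#eigenvalue_mset X. f x) / real n"
proof -
  obtain d where d: "eigenvalue_mset X = image_mset d (mset_set {..<n})"
    using symmetric_diagonalization[OF X] by blast
  let ?U = "uniform_count_measure {..<n}"
  have d_meas: "d \<in> ?U \<rightarrow>\<^sub>M borel"
    by (simp add: measurable_def space_uniform_count_measure sets_uniform_count_measure)
  have "empirical_law X = distr ?U borel d"
  proof (rule measure_eqI)
    fix A assume "A \<in> sets (empirical_law X)"
    then have A: "A \<in> sets borel"
      by simp
    have "(\<Sum>l\<in>#eigenvalue_mset X. emeasure (return borel l) A) = (\<Sum>k<n. indicator A (d k))"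
      using A by (simp add: d sum_unfold_sum_mset multiset.map_comp comp_def)
    also have "\<dots> = of_nat (card {k\<in>{..<n}. d k \<in> A})"
      by (simp add: indicator_def sum.If_cases Int_def)
    finally have "emeasure (empirical_law X) A = ennreal (1 / real n) * ennreal (real (card {k\<in>{..<n}. d k \<in> A}))"
      using A X(1) by (simp add: emeasure_empirical_law ennreal_of_nat_eq_real_of_nat)
    also have "\<dots> = ennreal (card {k\<in>{..<n}. d k \<in> A} / real n)"
      by (simp flip: ennreal_mult)
    also have "{k\<in>{..<n}. d k \<in> A} = d -` A \<inter> space ?U"
      by (auto simp: space_uniform_count_measure)
    also have "ennreal (card (d -` A \<inter> space ?U) / real n) = emeasure (distr ?U borel d) A"
      using A d_meas by (simp add: emeasure_distr space_uniform_count_measure emeasure_uniform_count_measure)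
    finally show "emeasure (empirical_law X) A = emeasure (distr ?U borel d) A" .
  qed simp
  then have "(\<integral>x. f x \<partial>empirical_law X) = (\<integral>k. f (d k) \<partial>?U)"
    using d_meas f by (simp add: integral_distr)
  also have "\<dots> = (\<Sum>k<n. f (d k)) / real n"
    by (subst integral_uniform_count_measure) auto
  finally show ?thesis
    by (simp add: d sum_unfold_sum_mset multiset.map_comp comp_def)
qed

definition upper_triangle :: "nat \<Rightarrow> (nat \<times> nat) set" where
  "upper_triangle n = {(i, j). i \<le> j \<and> j < n}"

text \<open>
  The symmetric matrix with independent entries \<open>y\<close>, read from the upper triangle only. Taking \<open>y\<close> on all
  pairs avoids restrictions in the Lipschitz bounds.
\<close>

definition wigner_mat :: "nat \<Rightarrow> (nat \<times> nat \<Rightarrow> real) \<Rightarrow> real mat" where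
  "wigner_mat n y = mat n n (\<lambda>(i, j). y (min i j, max i j) / sqrt (real n))"

lemma upper_triangle_subset: "upper_triangle n \<subseteq> {..<n} \<times> {..<n}"
  by (auto simp: upper_triangle_def)

lemma finite_upper_triangle: "finite (upper_triangle n)"
  using finite_subset[OF upper_triangle_subset] by simp

lemma card_upper_triangle_le: "card (upper_triangle n) \<le> n\<^sup>2"
  using card_mono[OF _ upper_triangle_subset[of n]] by (simp add: power2_eq_square)

lemma sum_min_max_le_upper_triangle:
  fixes h :: "nat \<times> nat \<Rightarrow> real"
  assumes h: "\<And>p. h p \<ge> 0"
  shows "(\<Sum>i<n. \<Sum>j<n. h (min i j, max i j)) \<le> 2 * (\<Sum>p\<in>upper_triangle n. h p)"
proof -
  let ?J = "{(i, j). j < i \<and> i < n}"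
  have J: "prod.swap ` ?J \<subseteq> upper_triangle n"
    by (auto simp: upper_triangle_def)
  have finJ: "finite ?J"
    by (rule finite_subset[of _ "{..<n} \<times> {..<n}"]) auto
  have "(\<Sum>i<n. \<Sum>j<n. h (min i j, max i j)) = (\<Sum>(i, j)\<in>{..<n} \<times> {..<n}. h (min i j, max i j))"
    by (simp add: sum.cartesian_product)
  also have "{..<n} \<times> {..<n} = upper_triangle n \<union> ?J"
    by (auto simp: upper_triangle_def)
  also have "(\<Sum>(i, j)\<in>upper_triangle n \<union> ?J. h (min i j, max i j)) =
      (\<Sum>(i, j)\<in>upper_triangle n. h (min i j, max i j)) + (\<Sum>(i, j)\<in>?J. h (min i j, max i j))"
    by (rule sum.union_disjoint) (auto simp: finJ finite_upper_triangle, auto simp: upper_triangle_def)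
  also have "(\<Sum>(i, j)\<in>upper_triangle n. h (min i j, max i j)) = (\<Sum>p\<in>upper_triangle n. h p)"
    by (rule sum.cong) (auto simp: upper_triangle_def)
  also have "(\<Sum>(i, j)\<in>?J. h (min i j, max i j)) = (\<Sum>p\<in>prod.swap ` ?J. h p)"
    by (subst sum.reindex) (auto simp: inj_on_def intro!: sum.cong)
  also have "\<dots> \<le> (\<Sum>p\<in>upper_triangle n. h p)"
    using J h by (intro sum_mono2) (auto simp: finite_upper_triangle)
  finally show ?thesis by simp
qed

lemma wigner_mat_symmetric:
  "wigner_mat n y \<in> carrier_mat n n" "transpose_mat (wigner_mat n y) = wigner_mat n y"
  by (auto simp: wigner_mat_def min.commute max.commute intro!: eq_matI)

text \<open>
  Changing one independent entry by \<open>t\<close> changes at most two matrix entries, each by \<open>t / sqrt n\<close>, and the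
  normalised eigenvalue sum by at most \<open>2 L |t| / n powr (3/2)\<close>. The power of \<open>n\<close> beats the number of
  entries, of order \<open>n\<^sup>2\<close>, once it is squared.
\<close>

lemma linear_statistic_lipschitz:
  fixes f :: "real \<Rightarrow> real"
  assumes f: "L-lipschitz_on UNIV f"
  shows "\<bar>(\<Sum>x\<in>#eigenvalue_mset (wigner_mat n y). f x) / real n - (\<Sum>x\<in>#eigenvalue_mset (wigner_mat n z). f x) / real n\<bar>
    \<le> 2 * L / (real n * sqrt (real n)) * (\<Sum>p\<in>upper_triangle n. \<bar>y p - z p\<bar>)"
proof -
  let ?S = "\<lambda>y. \<Sum>x\<in>#eigenvalue_mset (wigner_mat n y). f x"
  have L: "L \<ge> 0"
    using lipschitz_on_nonneg[OF f] .
  have "\<bar>?S y - ?S z\<bar> \<le> L * (\<Sum>i<n. \<Sum>j<n. \<bar>wigner_mat n y $$ (i, j) - wigner_mat n z $$ (i, j)\<bar>)"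
    by (rule eigenvalue_sum_lipschitz_l1[OF wigner_mat_symmetric wigner_mat_symmetric f])
  also have "(\<Sum>i<n. \<Sum>j<n. \<bar>wigner_mat n y $$ (i, j) - wigner_mat n z $$ (i, j)\<bar>)
      = (\<Sum>i<n. \<Sum>j<n. \<bar>y (min i j, max i j) - z (min i j, max i j)\<bar>) / sqrt n"
    by (simp add: wigner_mat_def sum_divide_distrib flip: diff_divide_distrib)
  also have "L * \<dots> \<le> L * (2 * (\<Sum>p\<in>upper_triangle n. \<bar>y p - z p\<bar>) / sqrt n)"
    using L sum_min_max_le_upper_triangle[of "\<lambda>p. \<bar>y p - z p\<bar>" n]
    by (intro mult_left_mono divide_right_mono) auto
  finally have "\<bar>?S y - ?S z\<bar> / real n \<le> L * (2 * (\<Sum>p\<in>upper_triangle n. \<bar>y p - z p\<bar>) / sqrt n) / real n"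
    by (rule divide_right_mono) simp
  moreover have "\<bar>?S y / real n - ?S z / real n\<bar> = \<bar>?S y - ?S z\<bar> / real n"
    by (simp flip: diff_divide_distrib)
  ultimately show ?thesis
    by (simp add: mult_ac)
qed

text \<open>
  The quantitative form of concentration: Chebyshev's inequality with a variance of order \<open>1 / n\<close>, from at most
  \<open>n\<^sup>2\<close> entries that contribute \<open>(2 L / n powr (3/2))\<^sup>2\<close> times the second moment each.
\<close>

lemma wigner_deviation_bound:
  fixes \<nu> :: "real measure" and M :: "'a measure" and Y :: "'a \<Rightarrow> real mat"
  assumes \<nu>: "prob_space \<nu>" "sets \<nu> = sets borel" "integrable \<nu> (\<lambda>x. x\<^sup>2)"
    and M: "prob_space M" and n: "n \<ge> 1"
    and dim: "\<And>\<omega>. \<omega> \<in> space M \<Longrightarrow> Y \<omega> \<in> carrier_mat n n"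
    and sym: "\<And>\<omega>. \<omega> \<in> space M \<Longrightarrow> transpose_mat (Y \<omega>) = Y \<omega>"
    and indep: "prob_space.indep_vars M (\<lambda>_. borel) (\<lambda>(i, j) \<omega>. Y \<omega> $$ (i, j)) {(i, j). i \<le> j \<and> j < n}"
    and distributed: "\<And>i j. i \<le> j \<Longrightarrow> j < n \<Longrightarrow> distr M borel (\<lambda>\<omega>. Y \<omega> $$ (i, j)) = \<nu>"
    and X: "\<And>\<omega>. \<omega> \<in> space M \<Longrightarrow> X \<omega> = (1 / sqrt (real n)) \<cdot>\<^sub>m Y \<omega>"
    and f: "L-lipschitz_on UNIV f" and \<epsilon>: "\<epsilon> > 0"
  shows "measure M {\<omega> \<in> space M. \<bar>(\<integral>x. f x \<partial>empirical_law (X \<omega>)) - (\<integral>\<omega>'. (\<integral>x. f x \<partial>empirical_law (X \<omega>')) \<partial>M)\<bar> \<ge> \<epsilon>}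
    \<le> 4 * L\<^sup>2 * (\<integral>y. y\<^sup>2 \<partial>\<nu>) / \<epsilon>\<^sup>2 / real n"
proof -
  interpret prob_space M by fact
  let ?I = "upper_triangle n" and ?P = "Pi\<^sub>M (upper_triangle n) (\<lambda>_. \<nu>)"
  define \<xi> where "\<xi> = (\<lambda>\<omega>. \<lambda>p\<in>?I. (\<lambda>(i, j). Y \<omega> $$ (i, j)) p)"
  define F where "F = (\<lambda>y. (\<Sum>x\<in>#eigenvalue_mset (wigner_mat n y). f x) / real n)"
  define C where "C = 2 * L / (real n * sqrt (real n))"
  have lip: "\<bar>F y - F z\<bar> \<le> C * (\<Sum>p\<in>?I. \<bar>y p - z p\<bar>)" for y z
    unfolding F_def C_def by (rule linear_statistic_lipschitz[OF f])
  note sq = l1_lipschitz_square_integrable[OF \<nu> finite_upper_triangle lip]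
  note var = l1_lipschitz_variance_le[OF \<nu> finite_upper_triangle lip]
  have f_meas: "f \<in> borel_measurable borel"
    using f by (intro borel_measurable_continuous_onI lipschitz_on_continuous_on)
  have nonempty: "?I \<noteq> {}"
    using n by (auto simp: upper_triangle_def intro!: exI[of _ 0])
  have indep': "indep_vars (\<lambda>_. borel) (\<lambda>p \<omega>. (\<lambda>(i, j). Y \<omega> $$ (i, j)) p) ?I"
    using indep by (simp add: upper_triangle_def split_def)
  then have rv: "(\<lambda>\<omega>. (\<lambda>(i, j). Y \<omega> $$ (i, j)) p) \<in> borel_measurable M" if "p \<in> ?I" for p
    using that by (auto simp: indep_vars_def)
  have \<xi>_meas: "\<xi> \<in> M \<rightarrow>\<^sub>M Pi\<^sub>M ?I (\<lambda>_. borel)"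
    unfolding \<xi>_def using rv by (rule measurable_restrict)
  have "distr M (Pi\<^sub>M ?I (\<lambda>_. borel)) \<xi> = (\<Pi>\<^sub>M p\<in>?I. distr M borel (\<lambda>\<omega>. (\<lambda>(i, j). Y \<omega> $$ (i, j)) p))"
    using indep_vars_iff_distr_eq_PiM'[OF nonempty, of "\<lambda>p \<omega>. (\<lambda>(i, j). Y \<omega> $$ (i, j)) p" "\<lambda>_. borel"] rv indep'
    by (simp add: \<xi>_def)
  also have "\<dots> = ?P"
    by (rule PiM_cong) (auto simp: upper_triangle_def distributed)
  finally have distr_\<xi>: "distr M (Pi\<^sub>M ?I (\<lambda>_. borel)) \<xi> = ?P" .
  have F_meas: "F \<in> borel_measurable (Pi\<^sub>M ?I (\<lambda>_. borel))"
    using l1_lipschitz_measurable[of F, OF lip] .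
  have integral_\<xi>: "(\<integral>\<omega>. g (\<xi> \<omega>) \<partial>M) = (\<integral>y. g y \<partial>?P)" if "g \<in> borel_measurable (Pi\<^sub>M ?I (\<lambda>_. borel))" for g :: "_ \<Rightarrow> real"
    using integral_distr[OF \<xi>_meas that] by (simp add: distr_\<xi>)
  (* The matrix is recovered from its upper triangle, so the joint law of the independent entries
     determines all expectations and probabilities below. *)
  have X_eq: "X \<omega> = wigner_mat n (\<xi> \<omega>)" if \<omega>: "\<omega> \<in> space M" for \<omega>
  proof (rule eq_matI)
    fix i j assume "i < dim_row (wigner_mat n (\<xi> \<omega>))" "j < dim_col (wigner_mat n (\<xi> \<omega>))"
    then have ij: "i < n" "j < n"
      by (simp_all add: wigner_mat_def)
    then have "Y \<omega> $$ (min i j, max i j) = Y \<omega> $$ (i, j)"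
      using arg_cong[OF sym[OF \<omega>], of "\<lambda>A. A $$ (i, j)"] dim[OF \<omega>] by (cases "i \<le> j") (auto simp: min_def max_def)
    moreover have "(min i j, max i j) \<in> ?I"
      using ij by (auto simp: upper_triangle_def)
    ultimately show "X \<omega> $$ (i, j) = wigner_mat n (\<xi> \<omega>) $$ (i, j)"
      using ij dim[OF \<omega>] by (simp add: X[OF \<omega>] wigner_mat_def \<xi>_def)
  qed (use dim[OF \<omega>] in \<open>simp_all add: X[OF \<omega>] wigner_mat_def\<close>)
  have stat: "(\<integral>x. f x \<partial>empirical_law (X \<omega>)) = F (\<xi> \<omega>)" if "\<omega> \<in> space M" for \<omega>
    unfolding X_eq[OF that] F_def by (rule integral_empirical_law[OF wigner_mat_symmetric n f_meas])
  have mean: "(\<integral>\<omega>. (\<integral>x. f x \<partial>empirical_law (X \<omega>)) \<partial>M) = expectation (\<lambda>\<omega>. F (\<xi> \<omega>))"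
    by (rule Bochner_Integration.integral_cong) (auto simp: stat)
  have rvF: "(\<lambda>\<omega>. F (\<xi> \<omega>)) \<in> borel_measurable M"
    using measurable_compose[OF \<xi>_meas F_meas] .
  have intF: "integrable M (\<lambda>\<omega>. (F (\<xi> \<omega>))\<^sup>2)"
    using integrable_distr[OF \<xi>_meas, of "\<lambda>y. (F y)\<^sup>2"] sq(2) by (simp add: distr_\<xi>)
  have "variance (\<lambda>\<omega>. F (\<xi> \<omega>)) = (\<integral>y. (F y - (\<integral>y. F y \<partial>?P))\<^sup>2 \<partial>?P)"
    unfolding integral_\<xi>[OF F_meas] by (rule integral_\<xi>) (use F_meas in measurable)
  also have "\<dots> \<le> card ?I * (C\<^sup>2 * (\<integral>y. y\<^sup>2 \<partial>\<nu>))"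
    by (rule var)
  also have "\<dots> \<le> (real n)\<^sup>2 * (C\<^sup>2 * (\<integral>y. y\<^sup>2 \<partial>\<nu>))"
    using card_upper_triangle_le[of n] by (intro mult_right_mono) (auto simp flip: of_nat_power)
  also have "\<dots> = 4 * L\<^sup>2 * (\<integral>y. y\<^sup>2 \<partial>\<nu>) / real n"
    using n by (simp add: C_def power_divide power_mult_distrib)
  finally have var_le: "variance (\<lambda>\<omega>. F (\<xi> \<omega>)) \<le> 4 * L\<^sup>2 * (\<integral>y. y\<^sup>2 \<partial>\<nu>) / real n" .
  have "{\<omega> \<in> space M. \<bar>(\<integral>x. f x \<partial>empirical_law (X \<omega>)) - (\<integral>\<omega>'. (\<integral>x. f x \<partial>empirical_law (X \<omega>')) \<partial>M)\<bar> \<ge> \<epsilon>}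
      = {\<omega> \<in> space M. \<bar>F (\<xi> \<omega>) - expectation (\<lambda>\<omega>. F (\<xi> \<omega>))\<bar> \<ge> \<epsilon>}"
    by (auto simp: mean stat)
  also have "prob \<dots> \<le> variance (\<lambda>\<omega>. F (\<xi> \<omega>)) / \<epsilon>\<^sup>2"
    by (rule Chebyshev_inequality[OF rvF intF \<epsilon>])
  also have "\<dots> \<le> 4 * L\<^sup>2 * (\<integral>y. y\<^sup>2 \<partial>\<nu>) / real n / \<epsilon>\<^sup>2"
    using var_le by (rule divide_right_mono) simp
  finally show ?thesis
    by (simp add: mult_ac)
qed

theorem theorem10:
  fixes \<nu> :: "real measure"
    and M :: "nat \<Rightarrow> 'a measure"
    and X Y :: "nat \<Rightarrow> 'a \<Rightarrow> real mat"
  assumes \<nu>: "prob_space \<nu>" "sets \<nu> = sets borel"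
    and second_moment: "integrable \<nu> (\<lambda>x. x\<^sup>2)"
    and prob: "\<And>n. n \<ge> 1 \<Longrightarrow> prob_space (M n)"
    and dim: "\<And>n \<omega>. n \<ge> 1 \<Longrightarrow> \<omega> \<in> space (M n) \<Longrightarrow> Y n \<omega> \<in> carrier_mat n n"
    and symmetric: "\<And>n \<omega>. n \<ge> 1 \<Longrightarrow> \<omega> \<in> space (M n) \<Longrightarrow> transpose_mat (Y n \<omega>) = Y n \<omega>"
    and indep: "\<And>n. n \<ge> 1 \<Longrightarrow> prob_space.indep_vars (M n) (\<lambda>_. borel)
                  (\<lambda>(i, j) \<omega>. Y n \<omega> $$ (i, j)) {(i, j). i \<le> j \<and> j < n}"
    and distributed: "\<And>n i j. n \<ge> 1 \<Longrightarrow> i \<le> j \<Longrightarrow> j < n \<Longrightarrow>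
                        distr (M n) borel (\<lambda>\<omega>. Y n \<omega> $$ (i, j)) = \<nu>"
    and X: "\<And>n \<omega>. n \<ge> 1 \<Longrightarrow> \<omega> \<in> space (M n) \<Longrightarrow> X n \<omega> = (1 / sqrt (real n)) \<cdot>\<^sub>m Y n \<omega>"
  shows "\<forall>\<epsilon>>0. \<forall>f :: real \<Rightarrow> real. (\<exists>L. L-lipschitz_on UNIV f) \<longrightarrow>
    (\<lambda>n. measure (M n) {\<omega> \<in> space (M n).
        \<bar>(\<integral>x. f x \<partial>empirical_law (X n \<omega>)) -
         (\<integral>\<omega>'. (\<integral>x. f x \<partial>empirical_law (X n \<omega>')) \<partial>M n)\<bar> \<ge> \<epsilon>})
    \<longlonglongrightarrow> 0"
proof (intro allI impI)
  fix \<epsilon> :: real and f :: "real \<Rightarrow> real"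
  assume \<epsilon>: "\<epsilon> > 0" and "\<exists>L. L-lipschitz_on UNIV f"
  then obtain L where f: "L-lipschitz_on UNIV f"
    by blast
  let ?p = "\<lambda>n. measure (M n) {\<omega> \<in> space (M n). \<bar>(\<integral>x. f x \<partial>empirical_law (X n \<omega>)) -
         (\<integral>\<omega>'. (\<integral>x. f x \<partial>empirical_law (X n \<omega>')) \<partial>M n)\<bar> \<ge> \<epsilon>}"
  let ?c = "4 * L\<^sup>2 * (\<integral>y. y\<^sup>2 \<partial>\<nu>) / \<epsilon>\<^sup>2"
  have bound: "?p n \<le> ?c / real n" if n: "n \<ge> 1" for n
    by (rule wigner_deviation_bound[OF \<nu> second_moment prob[OF n] n dim[OF n] symmetric[OF n]
          indep[OF n] distributed[OF n] X[OF n] f \<epsilon>])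
  show "?p \<longlonglongrightarrow> 0"
  proof (rule tendsto_sandwich[where f = "\<lambda>_. 0" and h = "\<lambda>n. ?c / real n"])
    show "(\<lambda>n. ?c / real n) \<longlonglongrightarrow> 0"
      by (rule lim_const_over_n)
    show "\<forall>\<^sub>F n in sequentially. ?p n \<le> ?c / real n"
      using eventually_ge_at_top[of 1] by eventually_elim (rule bound)
  qed auto
qed

end
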